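(* For $\lambda>5$, we have $$\mathcal{T}_{\mathbb{R}}(\Omega_\lambda)\le\frac{2\lambda-2}{\lfloor\lambda-5\rfloor+3}.$$
   Context: For $\lambda\ge 0$ let $\Omega_\lambda=(-1,1)\cup(\lambda-1,\lambda+1)\cup(-\lambda-1,-\lambda+1)\subset\mathbb{R}$. A function $f:\mathbb{R}\to\mathbb{C}$ is positive definite if $\sum_{j,k=1}^m z_j\overline{z_k}f(x_j-x_k)\ge 0$ for all finite choices of $x_1,\dots,x_m\in\mathbb{R}$ and $z_1,\dots,z_m\in\mathbb{C}$. For an open bounded set $\Omega\subset\mathbb{R}$ with $\Omega=-\Omega$ and $0\in\Omega$, the Turán constant is $$\mathcal{T}_{\mathbb{R}}(\Omega)=\sup\left\{\int_{\mathbb{R}}f(x)\,dx: f\in C(\mathbb{R}),\ f \text{ positive definite},\ f(0)=1,\ \operatorname{supp} f\subset\Omega\right\},$$ where $\operatorname{supp} f$ is the closed support of $f$ (the integrals in question are automatically real). *)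

theory Defs
  imports "HOL-Analysis.Analysis"
begin

definition Omega :: "real \<Rightarrow> real set" where
  "Omega l = {-1<..<1} \<union> {l-1<..<l+1} \<union> {-l-1<..<-l+1}"

text \<open>The set \<open>\<real>\<^sub>\<ge>\<^sub>0\<close> of complex numbers that are real and nonnegative expresses that
  the quadratic form is real as well as nonnegative; the points \<open>x j\<close> may repeat.\<close>

definition positive_definite :: "(real \<Rightarrow> complex) \<Rightarrow> bool" where
  "positive_definite f \<longleftrightarrow>
     (\<forall>m. \<forall>x :: nat \<Rightarrow> real. \<forall>z :: nat \<Rightarrow> complex.
        (\<Sum>j<m. \<Sum>k<m. z j * cnj (z k) * f (x j - x k)) \<in> \<real>\<^sub>\<ge>\<^sub>0)"

definition turan_class :: "real set \<Rightarrow> (real \<Rightarrow> complex) set" where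
  "turan_class \<Omega> = {f. continuous_on UNIV f \<and> positive_definite f \<and> f 0 = 1 \<and>
     closure {x. f x \<noteq> 0} \<subseteq> \<Omega>}"

text \<open>The integral of a positive definite function is real (\<open>f (-x) = cnj (f x)\<close>), so \<open>Re\<close>
  only changes the type. The supremum is taken in the extended reals, so that it
  is the least upper bound without any side conditions; for \<open>\<Omega>\<close> open, bounded, symmetric
  and containing 0 it is finite.\<close>

definition turan_constant :: "real set \<Rightarrow> ereal" where
  "turan_constant \<Omega> = (SUP f\<in>turan_class \<Omega>. ereal (Re (\<integral>x. f x \<partial>lborel)))"

end

theory Submission
  imports Defs
begin

text \<open>
  The bound is a packing (linear programming) bound. Let \<open>f\<close> be continuous, compactly supported
  and positive definite with \<open>f 0 = 1\<close>, and let \<open>\<Lambda> = B + p\<int>\<close> be a periodic set on whose nonzero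
  differences \<open>f\<close> vanishes. Then \<open>\<integral>f\<close> is at most \<open>p / card B\<close>, the reciprocal of the density
  of \<open>\<Lambda>\<close> (\<open>periodic_packing_bound\<close>).

  The reason: for a finite \<open>A \<subseteq> \<Lambda>\<close> and a translate \<open>x + A'\<close> of another finite \<open>A' \<subseteq> \<Lambda>\<close>,
  put weight \<open>1\<close> on the points of \<open>A\<close> and weight \<open>-1\<close> on those of \<open>x + A'\<close>. Within each of the two
  sets only the diagonal terms of the quadratic form survive, so positivity says
  \<open>2 Re (\<Sum>a\<in>A. \<Sum>a'\<in>A'. f (x + a' - a)) \<le> card A + card A'\<close>
  (\<open>positive_definite_cross_sum_le\<close>). Let \<open>A\<close> consist of \<open>N\<close> consecutive periods, let \<open>A'\<close> extend it
  by \<open>c\<close> periods on either side, with \<open>c\<close> so large that \<open>A'\<close> overlaps the support of \<open>f\<close>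
  around every point of \<open>A\<close>, and integrate over \<open>x \<in> [0, p]\<close>. Each pair of a point of \<open>A\<close> and
  a residue in \<open>B\<close> then contributes a whole copy of \<open>F = \<integral>f\<close>. With \<open>k = card B\<close> this
  gives \<open>2 (N k) (k F) \<le> p k (2 N + 2 c)\<close>, and \<open>N \<rightarrow> \<infinity>\<close> yields \<open>k F \<le> p\<close>.

  For \<open>\<Omega>\<^sub>\<lambda>\<close> a good packing consists of runs of \<open>k = \<lfloor>\<lambda>\<rfloor>\<close> consecutive integers, repeated with period
  \<open>p = \<lambda> + k\<close>: differences inside a run have absolute value between \<open>1\<close> and \<open>k - 1 \<le> \<lambda> - 1\<close>, and
  differences between two runs are at least \<open>p - (k - 1) = \<lambda> + 1\<close> in absolute value
  (\<open>int_translate_notin_Omega\<close>). Hence the Turan constant is at most \<open>(\<lambda> + k) / k\<close>, and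
  \<open>k \<le> \<lambda>\<close> makes this at most \<open>(2 \<lambda> - 2) / (k - 2)\<close>.
\<close>

section \<open>Positive definite functions\<close>

lemma positive_definite_finite:
  fixes x :: "'i \<Rightarrow> real" and z :: "'i \<Rightarrow> complex"
  assumes "positive_definite f" "finite I"
  shows "(\<Sum>i\<in>I. \<Sum>j\<in>I. z i * cnj (z j) * f (x i - x j)) \<in> \<real>\<^sub>\<ge>\<^sub>0"
proof -
  obtain h where h: "bij_betw h {..<card I} I"
    using ex_bij_betw_nat_finite[OF \<open>finite I\<close>] by (auto simp: atLeast0LessThan)
  have "(\<Sum>i\<in>I. \<Sum>j\<in>I. z i * cnj (z j) * f (x i - x j)) =
    (\<Sum>i<card I. \<Sum>j<card I. z (h i) * cnj (z (h j)) * f (x (h i) - x (h j)))"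
    by (simp add: sum.reindex_bij_betw[OF h, symmetric])
  moreover have "\<dots> \<in> \<real>\<^sub>\<ge>\<^sub>0"
    using assms(1)[unfolded positive_definite_def, rule_format, of "\<lambda>i. z (h i)" "\<lambda>i. x (h i)"]
    by simp
  ultimately show ?thesis by simp
qed

text \<open>The quadratic form at the points \<open>x\<close>, \<open>0\<close> with weights \<open>1\<close>, \<open>\<i>\<close> has imaginary part
  \<open>Re (f (- x)) - Re (f x)\<close>, which has to vanish because the form is real.\<close>

lemma positive_definite_Re_minus:
  assumes "positive_definite f"
  shows "Re (f (- x)) = Re (f x)"
proof -
  have f0: "Im (f 0) = 0"
    using assms[unfolded positive_definite_def, rule_format, where m = 1
        and x = "\<lambda>_. 0" and z = "\<lambda>_. 1"]
    by (simp add: complex_nonneg_Reals_iff)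
  have "Im (\<Sum>j<(2::nat). \<Sum>k<(2::nat). (if j = 0 then 1 else \<i>) * cnj (if k = 0 then 1 else \<i>) *
           f ((if j = 0 then x else 0) - (if k = 0 then x else 0))) = 0"
    using assms[unfolded positive_definite_def, rule_format, where m = 2
        and x = "\<lambda>j. if j = 0 then x else 0" and z = "\<lambda>j. if j = 0 then 1 else \<i>"]
    by (simp only: complex_nonneg_Reals_iff)
  with f0 show ?thesis
    by (simp add: numeral_2_eq_2)
qed

text \<open>Expanding the quadratic form with weight \<open>1\<close> on the points \<open>u i\<close> and weight \<open>-1\<close> on the
  points \<open>v j\<close> leaves the diagonal terms and two cross sums, whose real parts agree.\<close>

lemma positive_definite_cross_sum_le:
  fixes u :: "'i \<Rightarrow> real" and v :: "'j \<Rightarrow> real"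
  assumes pd: "positive_definite f" and f0: "f 0 = 1"
    and fin: "finite I" "finite J"
    and u: "\<And>i i'. i \<in> I \<Longrightarrow> i' \<in> I \<Longrightarrow> i \<noteq> i' \<Longrightarrow> f (u i - u i') = 0"
    and v: "\<And>j j'. j \<in> J \<Longrightarrow> j' \<in> J \<Longrightarrow> j \<noteq> j' \<Longrightarrow> f (v j - v j') = 0"
  shows "2 * (\<Sum>i\<in>I. \<Sum>j\<in>J. Re (f (v j - u i))) \<le> real (card I) + real (card J)"
proof -
  define z :: "'i + 'j \<Rightarrow> complex" where "z = case_sum (\<lambda>_. 1) (\<lambda>_. -1)"
  define x where "x = case_sum u v"
  have "0 \<le> Re (\<Sum>s\<in>I <+> J. \<Sum>t\<in>I <+> J. z s * cnj (z t) * f (x s - x t))"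
    using positive_definite_finite[OF pd, of "I <+> J" z x] fin
    by (simp add: complex_nonneg_Reals_iff)
  also have "(\<Sum>s\<in>I <+> J. \<Sum>t\<in>I <+> J. z s * cnj (z t) * f (x s - x t)) =
      (\<Sum>i\<in>I. \<Sum>i'\<in>I. f (u i - u i')) - (\<Sum>i\<in>I. \<Sum>j\<in>J. f (u i - v j))
      - (\<Sum>j\<in>J. \<Sum>i\<in>I. f (v j - u i)) + (\<Sum>j\<in>J. \<Sum>j'\<in>J. f (v j - v j'))"
    using fin by (simp add: sum.Plus z_def x_def sum.distrib sum_negf sum_subtractf)
  also have "(\<Sum>i\<in>I. \<Sum>i'\<in>I. f (u i - u i')) = (\<Sum>i\<in>I. \<Sum>i'\<in>I. if i = i' then 1 else 0)"
    by (intro sum.cong refl) (use u f0 in auto)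
  also have "\<dots> = of_nat (card I)"
    using fin by simp
  also have "(\<Sum>j\<in>J. \<Sum>j'\<in>J. f (v j - v j')) = (\<Sum>j\<in>J. \<Sum>j'\<in>J. if j = j' then 1 else 0)"
    by (intro sum.cong refl) (use v f0 in auto)
  also have "\<dots> = of_nat (card J)"
    using fin by simp
  also have "(\<Sum>j\<in>J. \<Sum>i\<in>I. f (v j - u i)) = (\<Sum>i\<in>I. \<Sum>j\<in>J. f (v j - u i))"
    by (rule sum.swap)
  finally have "0 \<le> real (card I) - (\<Sum>i\<in>I. \<Sum>j\<in>J. Re (f (u i - v j)))
      - (\<Sum>i\<in>I. \<Sum>j\<in>J. Re (f (v j - u i))) + real (card J)"
    by simp
  moreover have "Re (f (u i - v j)) = Re (f (v j - u i))" for i j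
    using positive_definite_Re_minus[OF pd, of "v j - u i"] by simp
  ultimately show ?thesis by simp
qed

section \<open>Integrals of continuous functions of bounded support\<close>

text \<open>The intervals \<open>[e + p n, e + p (n + 1)]\<close> for \<open>n < K\<close> tile \<open>[e, e + p K]\<close>.\<close>

lemma integral_sum_translates:
  fixes g :: "real \<Rightarrow> real"
  assumes g: "continuous_on UNIV g" and "p > 0"
  shows "(\<Sum>n<K. integral {0..p} (\<lambda>x. g (x + (e + p * real n)))) = integral {e..e + p * real K} g"
proof (induction K)
  case 0
  then show ?case by simp
next
  case (Suc K)
  have int: "g integrable_on {a..b}" for a b
    by (rule integrable_continuous_interval) (rule continuous_on_subset[OF g], simp)
  define c where "c = e + p * real K"
  have "integral {0..p} (\<lambda>x. g (x + c)) = integral {c..c + p} g"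
    using integral_shift_Icc_real[of 0 p g c] by (simp add: add.commute o_def)
  moreover have "integral {e..c} g + integral {c..c + p} g = integral {e..c + p} g"
    by (rule Henstock_Kurzweil_Integration.integral_combine) (use \<open>p > 0\<close> int in \<open>auto simp: c_def\<close>)
  moreover have "e + p * real (Suc K) = c + p"
    by (simp add: c_def algebra_simps)
  ultimately show ?case
    using Suc unfolding sum.lessThan_Suc c_def[symmetric] by simp
qed

lemma integral_eq_lborel_bounded_support:
  fixes f :: "real \<Rightarrow> complex"
  assumes f: "continuous_on UNIV f" and supp: "\<And>x. x \<notin> {-R..R} \<Longrightarrow> f x = 0"
    and ab: "a \<le> -R" "R \<le> b"
  shows "integral {a..b} (\<lambda>x. Re (f x)) = Re (\<integral>x. f x \<partial>lborel)"
proof -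
  have "integrable lborel (\<lambda>x. indicator {-R..R} x *\<^sub>R f x)"
    by (rule borel_integrable_compact) (use f continuous_on_subset in auto)
  moreover have "(\<lambda>x. indicator {-R..R} x *\<^sub>R f x) = f"
    using supp by (auto simp: fun_eq_iff indicator_def)
  ultimately have intf: "integrable lborel f" by simp
  then have "((\<lambda>x. Re (f x)) has_integral (\<integral>x. Re (f x) \<partial>lborel)) UNIV"
    by (intro has_integral_integral_lborel integrable_Re)
  then have "integral UNIV (\<lambda>x. Re (f x)) = (\<integral>x. Re (f x) \<partial>lborel)"
    by (rule integral_unique)
  moreover have "integral UNIV (\<lambda>x. if x \<in> {a..b} then Re (f x) else 0) =
      integral {a..b} (\<lambda>x. Re (f x))"
    by (rule integral_restrict_UNIV)
  moreover have "(\<lambda>x. if x \<in> {a..b} then Re (f x) else 0) = (\<lambda>x. Re (f x))"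
    using supp ab by (auto simp: fun_eq_iff)
  ultimately show ?thesis
    using intf by (simp add: integral_Re)
qed

section \<open>The packing bound\<close>

text \<open>Here \<open>B + p\<int>\<close> is the packing. Its finite pieces are indexed by pairs \<open>(m, b)\<close>, a period
  number and a residue, so that \<open>pack\<close> is exactly what makes the off-diagonal terms vanish.\<close>

theorem periodic_packing_bound:
  fixes B :: "real set"
  assumes pd: "positive_definite f" and cont: "continuous_on UNIV f" and f0: "f 0 = 1"
    and supp: "\<And>x. x \<notin> {-R..R} \<Longrightarrow> f x = 0"
    and B: "finite B" and p: "p > 0"
    and pack: "\<And>b b' m. b \<in> B \<Longrightarrow> b' \<in> B \<Longrightarrow> m \<noteq> 0 \<or> b \<noteq> b' \<Longrightarrow> f (p * of_int m + (b - b')) = 0"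
  shows "real (card B) * Re (\<integral>x. f x \<partial>lborel) \<le> p"
proof (cases "B = {}")
  case True
  with p show ?thesis by simp
next
  case False
  define F where "F = Re (\<integral>x. f x \<partial>lborel)"
  define k where "k = real (card B)"
  have k: "k > 0" using False B by (simp add: k_def card_gt_0_iff)
  obtain D where D: "\<And>b. b \<in> B \<Longrightarrow> \<bar>b\<bar> \<le> D"
    using finite_imp_bounded[OF B] by (auto simp: bounded_iff)
  \<comment> \<open>The number of extra periods on either side: the residues shift the window by up to \<open>2 D\<close>.\<close>
  obtain c :: nat where "(\<bar>R\<bar> + 2 * D) / p \<le> real c"
    using real_arch_simple by blast
  with p have c: "\<bar>R\<bar> + 2 * D \<le> p * real c"
    by (simp add: field_simps)
  define u where "u = (\<lambda>(m, b). p * real m + b)"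
  define v where "v = (\<lambda>x (m, b). x + p * (real m - real c) + b)"
  have gcont: "continuous_on UNIV (\<lambda>x. Re (f x))"
    by (intro continuous_intros cont)
  have pack': "f (p * (real m - real n) + (b - b')) = 0"
    if "b \<in> B" "b' \<in> B" "(m, b) \<noteq> (n, b')" for b b' m n
    using pack[of b b' "int m - int n"] that by auto
  have bound: "k * F \<le> p + p * c / real N" if N: "N > 0" for N
  proof -
    let ?I = "{..<N} \<times> B" and ?J = "{..<N + 2 * c} \<times> B"
    have le: "2 * (\<Sum>i\<in>?I. \<Sum>j\<in>?J. Re (f (v x j - u i))) \<le> k * (2 * real N + 2 * real c)" for x
    proof -
      have "2 * (\<Sum>i\<in>?I. \<Sum>j\<in>?J. Re (f (v x j - u i))) \<le> real (card ?I) + real (card ?J)"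
      proof (rule positive_definite_cross_sum_le[OF pd f0])
        fix i i' assume "i \<in> ?I" "i' \<in> ?I" "i \<noteq> i'"
        moreover have "u i - u i' = p * (real (fst i) - real (fst i')) + (snd i - snd i')"
          by (simp add: u_def case_prod_beta algebra_simps)
        ultimately show "f (u i - u i') = 0"
          using pack'[of "snd i" "snd i'" "fst i" "fst i'"] by auto
      next
        fix i i' assume "i \<in> ?J" "i' \<in> ?J" "i \<noteq> i'"
        moreover have "v x i - v x i' = p * (real (fst i) - real (fst i')) + (snd i - snd i')"
          by (simp add: v_def case_prod_beta algebra_simps)
        ultimately show "f (v x i - v x i') = 0"
          using pack'[of "snd i" "snd i'" "fst i" "fst i'"] by auto
      qed (use B in auto)
      then show ?thesis
        by (simp add: card_cartesian_product k_def algebra_simps)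
    qed
    have intg: "(\<lambda>x. Re (f (v x j - u i))) integrable_on {0..p}" for i j
      unfolding v_def case_prod_beta
      by (intro integrable_continuous_interval continuous_intros
          continuous_on_compose2[OF cont]) auto
    \<comment> \<open>As \<open>n\<close> runs over all periods, the translates of \<open>[0, p]\<close> tile a window containing the
      support of \<open>f\<close>, so each residue \<open>b'\<close> contributes \<open>F\<close>.\<close>
    have inner: "(\<Sum>j\<in>?J. integral {0..p} (\<lambda>x. Re (f (v x j - u i)))) = k * F"
      if i: "i \<in> ?I" for i
    proof -
      obtain m b where mb: "i = (m, b)" "m < N" "b \<in> B" using i by auto
      have "(\<Sum>n<N + 2 * c. integral {0..p} (\<lambda>x. Re (f (v x (n, b') - u i)))) = F"
        if b': "b' \<in> B" for b'
      proof -
        define e where "e = b' - b - p * (real m + real c)"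
        have bb: "\<bar>b' - b\<bar> \<le> 2 * D"
          using D[OF b'] D[OF mb(3)] by linarith
        have "v x (n, b') - u i = x + (e + p * real n)" for x n
          by (simp add: v_def u_def mb e_def algebra_simps)
        then have "(\<Sum>n<N + 2 * c. integral {0..p} (\<lambda>x. Re (f (v x (n, b') - u i)))) =
            integral {e..e + p * real (N + 2 * c)} (\<lambda>x. Re (f x))"
          using integral_sum_translates[OF gcont p, of e "N + 2 * c"] by simp
        also have "\<dots> = F"
          unfolding F_def
        proof (rule integral_eq_lborel_bounded_support[OF cont supp])
          have "0 \<le> p * real m" using p by simp
          then show "e \<le> - R"
            using c bb by (simp add: e_def algebra_simps)
          have "p * real m \<le> p * real N" using p mb by simp
          then show "R \<le> e + p * real (N + 2 * c)"
            using c bb by (simp add: e_def algebra_simps)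
        qed
        finally show ?thesis .
      qed
      then have "(\<Sum>b'\<in>B. \<Sum>n<N + 2 * c. integral {0..p} (\<lambda>x. Re (f (v x (n, b') - u i)))) = k * F"
        by (simp add: k_def)
      then show ?thesis
        by (subst (asm) sum.swap) (simp add: sum.cartesian_product case_prod_beta)
    qed
    have "integral {0..p} (\<lambda>x. 2 * (\<Sum>i\<in>?I. \<Sum>j\<in>?J. Re (f (v x j - u i)))) \<le>
        integral {0..p} (\<lambda>x. k * (2 * real N + 2 * real c))"
      by (rule integral_le)
         (use le B in \<open>auto intro!: integrable_on_mult_right integrable_sum intg\<close>)
    also have "integral {0..p} (\<lambda>x. 2 * (\<Sum>i\<in>?I. \<Sum>j\<in>?J. Re (f (v x j - u i)))) =
        2 * (\<Sum>i\<in>?I. \<Sum>j\<in>?J. integral {0..p} (\<lambda>x. Re (f (v x j - u i))))"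
      using B by (simp add: integral_sum integrable_sum intg)
    also have "\<dots> = 2 * (real N * k * (k * F))"
      using inner by (simp add: card_cartesian_product k_def)
    finally have "2 * (real N * k * (k * F)) \<le> p * (k * (2 * real N + 2 * real c))"
      using p by (simp add: ac_simps)
    then have "(2 * k) * (real N * (k * F)) \<le> (2 * k) * (p * (real N + real c))"
      by (simp add: algebra_simps)
    then have "real N * (k * F) \<le> p * (real N + real c)"
      using k by (subst (asm) mult_le_cancel_left_pos) auto
    then show ?thesis
      using N by (simp add: field_simps)
  qed
  have "(\<lambda>N. p + p * c / real N) \<longlonglongrightarrow> p + 0"
    by (intro tendsto_add tendsto_const lim_const_over_n)
  then have "k * F \<le> p + 0"
    by (rule tendsto_lowerbound)
       (use bound in \<open>auto intro: eventually_mono[OF eventually_gt_at_top[of 0]]\<close>)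
  then show ?thesis by (simp add: k_def F_def)
qed

section \<open>A packing for three intervals\<close>

lemma int_translate_notin_Omega:
  fixes l :: real and d m :: int
  assumes l: "l \<ge> 1" and d: "\<bar>d\<bar> \<le> \<lfloor>l\<rfloor> - 1" and "m \<noteq> 0 \<or> d \<noteq> 0"
  shows "(l + of_int \<lfloor>l\<rfloor>) * of_int m + of_int d \<notin> Omega l"
proof -
  define p where "p = l + of_int \<lfloor>l\<rfloor>"
  have d': "\<bar>of_int d :: real\<bar> \<le> of_int \<lfloor>l\<rfloor> - 1"
    using d by linarith
  have p: "p \<ge> 0" "p = l + of_int \<lfloor>l\<rfloor>" using l by (simp_all add: p_def)
  consider "m = 0" "d \<noteq> 0" | "m \<ge> 1" | "m \<le> -1"
    using assms(3) by linarith
  then have "p * of_int m + of_int d \<notin> Omega l"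
  proof cases
    case 1
    then have "\<bar>of_int d :: real\<bar> \<ge> 1" by linarith
    moreover have "\<bar>of_int d :: real\<bar> \<le> l - 1"
      using d' of_int_floor_le[of l] by linarith
    ultimately show ?thesis using 1 by (auto simp: Omega_def)
  next
    case 2
    then have "p * of_int m \<ge> p * 1"
      by (intro mult_left_mono p(1)) linarith
    with d' p(2) have "p * of_int m + of_int d \<ge> l + 1" by linarith
    with l show ?thesis by (auto simp: Omega_def)
  next
    case 3
    then have "p * of_int m \<le> p * (-1)"
      by (intro mult_left_mono p(1)) linarith
    with d' p(2) have "p * of_int m + of_int d \<le> - l - 1" by linarith
    with l show ?thesis by (auto simp: Omega_def)
  qed
  then show ?thesis unfolding p_def .
qed

lemma turan_class_Omega_integral_le:
  assumes l: "l \<ge> 1" and f: "f \<in> turan_class (Omega l)"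
  shows "of_int \<lfloor>l\<rfloor> * Re (\<integral>x. f x \<partial>lborel) \<le> l + of_int \<lfloor>l\<rfloor>"
proof -
  define B :: "real set" where "B = of_int ` {0..<\<lfloor>l\<rfloor>}"
  have pd: "positive_definite f" and cont: "continuous_on UNIV f" and f0: "f 0 = 1"
    and cl: "closure {x. f x \<noteq> 0} \<subseteq> Omega l"
    using f by (auto simp: turan_class_def)
  have zero: "f x = 0" if "x \<notin> Omega l" for x
    using cl subsetD[OF closure_subset, of x "{x. f x \<noteq> 0}"] that by auto
  have "real (card B) * Re (\<integral>x. f x \<partial>lborel) \<le> l + of_int \<lfloor>l\<rfloor>"
  proof (rule periodic_packing_bound[OF pd cont f0, where R = "l + 1"])
    show "f x = 0" if "x \<notin> {-(l + 1)..l + 1}" for x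
      by (rule zero) (use that l in \<open>auto simp: Omega_def\<close>)
    show "f ((l + of_int \<lfloor>l\<rfloor>) * of_int m + (b - b')) = 0"
      if "b \<in> B" "b' \<in> B" and m: "m \<noteq> 0 \<or> b \<noteq> b'" for b b' m
    proof -
      obtain i j where ij: "b = of_int i" "b' = of_int j" "i \<in> {0..<\<lfloor>l\<rfloor>}" "j \<in> {0..<\<lfloor>l\<rfloor>}"
        using \<open>b \<in> B\<close> \<open>b' \<in> B\<close> by (auto simp: B_def)
      then have "\<bar>i - j\<bar> \<le> \<lfloor>l\<rfloor> - 1" by auto
      then have "(l + of_int \<lfloor>l\<rfloor>) * of_int m + of_int (i - j) \<notin> Omega l"
        by (rule int_translate_notin_Omega[OF l]) (use m ij in auto)
      then show ?thesis
        using zero ij by simp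
    qed
    have "of_int \<lfloor>l\<rfloor> \<ge> (0 :: real)" using l by simp
    then show "0 < l + of_int \<lfloor>l\<rfloor>" using l by linarith
  qed (simp add: B_def)
  moreover have "real (card B) = of_int \<lfloor>l\<rfloor>"
    using l by (simp add: B_def card_image inj_on_def)
  ultimately show ?thesis by simp
qed

theorem proposition5p3:
  fixes l :: real
  assumes "l > 5"
  shows "turan_constant (Omega l) \<le> ereal ((2 * l - 2) / (of_int \<lfloor>l - 5\<rfloor> + 3))"
  unfolding turan_constant_def
proof (rule SUP_least)
  fix f assume f: "f \<in> turan_class (Omega l)"
  define F where "F = Re (\<integral>x. f x \<partial>lborel)"
  define k :: real where "k = of_int \<lfloor>l\<rfloor>"
  have "\<lfloor>l\<rfloor> \<ge> 5" using assms by linarith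
  then have k: "k \<ge> 5" "k \<le> l" by (simp_all add: k_def)
  have "k * F \<le> l + k"
    using turan_class_Omega_integral_le[OF _ f] assms by (simp add: F_def k_def)
  then have "F \<le> (l + k) / k"
    using k by (simp add: field_simps)
  also have "\<dots> \<le> (2 * l - 2) / (k - 2)"
  proof -
    have "k * k \<le> l * k" using k by (intro mult_right_mono) auto
    then have "(l + k) * (k - 2) \<le> (2 * l - 2) * k"
      using assms by (simp add: algebra_simps)
    then show ?thesis using k by (simp add: pos_divide_le_eq pos_le_divide_eq)
  qed
  also have "k - 2 = of_int \<lfloor>l - 5\<rfloor> + 3"
    by (simp add: k_def)
  finally show "ereal (Re (\<integral>x. f x \<partial>lborel)) \<le> ereal ((2 * l - 2) / (of_int \<lfloor>l - 5\<rfloor> + 3))"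
    by (simp add: F_def)
qed

end
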